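(* For every positive integer $r$, the probability $q_n$ that a uniformly random labeled tournament of size $n$ is irreducible satisfies, as $n\to\infty$ (with $r$ fixed), $$q_n = 1 - \sum_{k=1}^{r-1} \big(2i_k-i_k^{(2)}\big) \binom{n}{k} \frac{2^{k(k+1)/2}}{2^{nk}} + O\left(\frac{n^r}{2^{nr}}\right),$$ where $i_k$ is the number of irreducible labeled tournaments of size $k$ and $i_k^{(2)}$ is the number of labeled tournaments of size $k$ with two irreducible components.
   Context: A labeled tournament of size $n$ is a tournament on the vertex set $\{1,\ldots,n\}$, i.e. a directed graph in which every pair of distinct vertices is joined by exactly one directed edge (and there are no loops). There are $2^{\binom n2}$ of them, and a random labeled tournament of size $n$ is chosen uniformly, each having probability $1/2^{\binom n2}$. Thus $q_n = i_n/2^{\binom n2}$. A tournament (with at least one vertex) is irreducible if for every partition $A\sqcup B$ of its vertex set into two nonempty parts there exist an edge from $A$ to $B$ and an edge from $B$ to $A$ (equivalently, it is strongly connected). In particular the one-vertex tournament is irreducible. The irreducible components of a tournament are its strongly connected components. Thus $i_k^{(2)}$ counts the labeled tournaments of size $k$ having exactly two strongly connected components; equivalently, those whose vertex set splits into an ordered pair of nonempty sets $(V_1,V_2)$ such that the subtournaments induced on $V_1$ and on $V_2$ are irreducible and all edges between $V_1$ and $V_2$ are directed from $V_1$ to $V_2$. For example $i_1^{(2)}=0$ and $i_2^{(2)}=2$. The constant implied by $O(\cdot)$ may depend on $r$. An empty sum is $0$. *)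

theory Defs
  imports
    "HOL-Probability.Probability_Mass_Function"
    "HOL-Library.Landau_Symbols"
    "Graph_Theory.Digraph_Component"
begin

definition tournament :: "'a pair_pre_digraph \<Rightarrow> bool" where
  "tournament T \<longleftrightarrow> pair_digraph T \<and>
     (\<forall>u \<in> pverts T. \<forall>v \<in> pverts T. u \<noteq> v \<longrightarrow> ((u, v) \<in> parcs T \<longleftrightarrow> (v, u) \<notin> parcs T))"

definition labeled_tournaments :: "nat \<Rightarrow> nat pair_pre_digraph set" where
  "labeled_tournaments n = {T. tournament T \<and> pverts T = {1..n}}"

definition irreducible_tournament :: "'a pair_pre_digraph \<Rightarrow> bool" where
  "irreducible_tournament T \<longleftrightarrow> tournament T \<and> pverts T \<noteq> {} \<and>
     (\<forall>A B. A \<union> B = pverts T \<and> A \<inter> B = {} \<and> A \<noteq> {} \<and> B \<noteq> {} \<longrightarrow>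
       (\<exists>a \<in> A. \<exists>b \<in> B. (a, b) \<in> parcs T) \<and> (\<exists>a \<in> A. \<exists>b \<in> B. (b, a) \<in> parcs T))"

text \<open>The irreducible components of a tournament are its strongly connected components.\<close>

definition irreducible_components :: "'a pair_pre_digraph \<Rightarrow> ('a, 'a \<times> 'a) pre_digraph set" where
  "irreducible_components T = pre_digraph.sccs (with_proj T)"

definition num_irreducible :: "nat \<Rightarrow> nat" where
  "num_irreducible k = card {T \<in> labeled_tournaments k. irreducible_tournament T}"

definition num_two_components :: "nat \<Rightarrow> nat" where
  "num_two_components k = card {T \<in> labeled_tournaments k. card (irreducible_components T) = 2}"

lemma finite_labeled_tournaments: "finite (labeled_tournaments n)"
proof (rule finite_subset)
  show "labeled_tournaments n
      \<subseteq> (\<lambda>E. \<lparr>pverts = {1..n}, parcs = E\<rparr>) ` Pow ({1..n} \<times> {1..n})"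
  proof
    fix T assume "T \<in> labeled_tournaments n"
    then have T: "pair_digraph T" "pverts T = {1..n}"
      by (auto simp: labeled_tournaments_def tournament_def)
    then interpret pair_digraph T by simp
    have "parcs T \<subseteq> {1..n} \<times> {1..n}"
      using in_arcsD1 in_arcsD2 T(2) by auto
    moreover have "T = \<lparr>pverts = {1..n}, parcs = parcs T\<rparr>"
      using T(2) by simp
    ultimately show "T \<in> (\<lambda>E. \<lparr>pverts = {1..n}, parcs = E\<rparr>) ` Pow ({1..n} \<times> {1..n})"
      by blast
  qed
qed simp

lemma labeled_tournaments_nonempty: "labeled_tournaments n \<noteq> {}"
proof -
  have "\<lparr>pverts = {1..n}, parcs = {(u, v). u \<in> {1..n} \<and> v \<in> {1..n} \<and> u < v}\<rparr>
      \<in> labeled_tournaments n"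
    unfolding labeled_tournaments_def tournament_def
    by (auto intro!: pair_digraph.intro pair_fin_digraph.intro pair_wf_digraph.intro
        pair_loopfree_digraph.intro pair_fin_digraph_axioms.intro
        pair_loopfree_digraph_axioms.intro
        intro: finite_subset[of _ "{1..n} \<times> {1..n}"])
  then show ?thesis by blast
qed

text \<open>
  The two lemmas above ensure that the uniform distribution below is not the junk value of
  \<^const>\<open>pmf_of_set\<close> on an empty or infinite set.
\<close>

definition prob_irreducible :: "nat \<Rightarrow> real" where
  "prob_irreducible n =
     measure_pmf.prob (pmf_of_set (labeled_tournaments n)) {T. irreducible_tournament T}"

end

theory Submission
  imports Defs "HOL-Computational_Algebra.Formal_Power_Series"
begin

text \<open>
  A tournament on a nonempty vertex set has a unique initial strongly connected component: the
  nonempty sets that no arc enters are linearly ordered by inclusion, and the least of them is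
  irreducible. Splitting off this component, and joining it to an arbitrary
  tournament on the remaining vertices, gives
  \<open>t\<^sub>n = (\<Sum>k\<le>n. (n choose k) i\<^sub>k t\<^sub>n\<^sub>-\<^sub>k)\<close> for \<open>n \<ge> 1\<close>, where \<open>t\<^sub>n\<close> is \<open>2\<close> to the power
  \<open>n choose 2\<close>. A tournament has two components exactly if the remaining part is irreducible
  as well, whence \<open>i\<^sup>(\<^sup>2\<^sup>)\<^sub>n = (\<Sum>k\<le>n. (n choose k) i\<^sub>k i\<^sub>n\<^sub>-\<^sub>k)\<close>. In exponential generating functions,
  \<open>T (1 - I) = 1\<close>, and the numbers \<open>c\<^sub>k\<close> with \<open>c\<^sub>0 = 1\<close> and \<open>c\<^sub>k = i\<^sup>(\<^sup>2\<^sup>)\<^sub>k - 2 i\<^sub>k\<close> for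
  \<open>k \<ge> 1\<close> are the coefficients of \<open>(1 - I)\<^sup>2\<close>, so that \<open>T (1 - I)\<^sup>2 = 1 - I\<close>
  (lemma \<open>binomial_convolution_tournaments_coeff\<close>).

  Let \<open>e\<^sub>r(n)\<close> be the error after the terms \<open>k < r\<close> of the expansion of \<open>i\<^sub>n\<close>. In the first recurrence
  the sum over \<open>k\<close> is dominated by both ends: small \<open>k\<close>, where the factor \<open>t\<^sub>n\<^sub>-\<^sub>k\<close> is explicit, and
  \<open>k = n - j\<close> with small \<open>j\<close>, where the unknown \<open>i\<^sub>n\<^sub>-\<^sub>j\<close> can be replaced by its own expansion of order
  \<open>r - j\<close>. All explicit terms then cancel because of \<open>T (1 - I)\<^sup>2 = 1 - I\<close>, and what is left is an
  exact recurrence (lemma \<open>remainder_recurrence\<close>) expressing \<open>e\<^sub>r(n)\<close> by the errors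
  \<open>e\<^sub>r\<^sub>-\<^sub>j(n-j)\<close> with \<open>1 \<le> j < r\<close> and the middle part \<open>r \<le> k \<le> n - r\<close> of the sum. The middle part is
  of order \<open>n\<^sup>r t\<^sub>n\<^sub>-\<^sub>r\<close> (lemma \<open>middle_bound\<close>), so \<open>e\<^sub>r\<close> is too, by induction on \<open>r\<close>. Division
  by \<open>t\<^sub>n\<close> turns this into the statement about probabilities.
\<close>

section \<open>Tournaments as arc sets and their initial components\<close>

text \<open>
  For a fixed vertex set a tournament is determined by its arcs. Arc sets can be restricted, united and
  counted without carrying the vertex set along in a record.
\<close>

definition tournament_arcs :: "'a set \<Rightarrow> 'a rel set" where
  "tournament_arcs V = {E. E \<subseteq> V \<times> V \<and> (\<forall>u v. (u, v) \<in> E \<longrightarrow> (v, u) \<notin> E) \<and>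
     (\<forall>u\<in>V. \<forall>v\<in>V. u \<noteq> v \<longrightarrow> (u, v) \<in> E \<or> (v, u) \<in> E)}"

text \<open>
  In a tournament, a dominant set is a nonempty set that no arc enters from outside, so the proper
  ones are the witnesses against irreducibility.
\<close>

definition dominant :: "'a set \<Rightarrow> 'a rel \<Rightarrow> 'a set \<Rightarrow> bool" where
  "dominant V E S \<longleftrightarrow> S \<subseteq> V \<and> S \<noteq> {} \<and> S \<times> (V - S) \<subseteq> E"

definition irreducible_arcs :: "'a set \<Rightarrow> 'a rel set" where
  "irreducible_arcs V = {E \<in> tournament_arcs V. V \<noteq> {} \<and> (\<forall>S. dominant V E S \<longrightarrow> S = V)}"

abbreviation induced_arcs :: "'a rel \<Rightarrow> 'a set \<Rightarrow> 'a rel" where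
  "induced_arcs E S \<equiv> E \<inter> S \<times> S"

lemma tournament_arcs_finite: "finite V \<Longrightarrow> finite (tournament_arcs V)"
  by (rule finite_subset[of _ "Pow (V \<times> V)"]) (auto simp: tournament_arcs_def)

lemma irreducible_arcs_nonempty: "E \<in> irreducible_arcs V \<Longrightarrow> V \<noteq> {}"
  by (simp add: irreducible_arcs_def)

lemma irreducible_arcs_subset: "irreducible_arcs V \<subseteq> tournament_arcs V"
  by (auto simp: irreducible_arcs_def)

lemma tournament_arcs_asym: "E \<in> tournament_arcs V \<Longrightarrow> (u, v) \<in> E \<Longrightarrow> (v, u) \<notin> E"
  by (simp add: tournament_arcs_def)

lemma tournament_arcs_total:
  "E \<in> tournament_arcs V \<Longrightarrow> u \<in> V \<Longrightarrow> v \<in> V \<Longrightarrow> u \<noteq> v \<Longrightarrow> (v, u) \<notin> E \<Longrightarrow> (u, v) \<in> E"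
  by (auto simp: tournament_arcs_def)

lemma tournament_arcs_sub: "E \<in> tournament_arcs V \<Longrightarrow> E \<subseteq> V \<times> V"
  by (simp add: tournament_arcs_def)

lemma tournament_arcsI:
  assumes "E \<subseteq> V \<times> V" "\<And>u v. (u, v) \<in> E \<Longrightarrow> (v, u) \<notin> E"
    "\<And>u v. u \<in> V \<Longrightarrow> v \<in> V \<Longrightarrow> u \<noteq> v \<Longrightarrow> (u, v) \<notin> E \<Longrightarrow> (v, u) \<in> E"
  shows "E \<in> tournament_arcs V"
proof -
  have "\<forall>u v. (u, v) \<in> E \<longrightarrow> (v, u) \<notin> E" using assms(2) by blast
  moreover have "\<forall>u\<in>V. \<forall>v\<in>V. u \<noteq> v \<longrightarrow> (u, v) \<in> E \<or> (v, u) \<in> E" using assms(3) by blast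
  ultimately show ?thesis using assms(1) unfolding tournament_arcs_def mem_Collect_eq by (intro conjI)
qed

lemma tournament_arcs_induced:
  "E \<in> tournament_arcs V \<Longrightarrow> S \<subseteq> V \<Longrightarrow> induced_arcs E S \<in> tournament_arcs S"
  by (rule tournament_arcsI)
    (auto dest: tournament_arcs_asym intro: tournament_arcs_total)

text \<open>
  If neither set contained the other, a vertex in the first difference and one in the second would
  have arcs in both directions.
\<close>

lemma dominant_linear:
  assumes "E \<in> tournament_arcs V" "dominant V E S" "dominant V E S'"
  shows "S \<subseteq> S' \<or> S' \<subseteq> S"
proof (rule ccontr)
  assume "\<not> ?thesis"
  then obtain a b where "a \<in> S" "a \<notin> S'" "b \<in> S'" "b \<notin> S" by blast
  with assms(2,3) have "(a, b) \<in> E" "(b, a) \<in> E" unfolding dominant_def by blast+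
  with tournament_arcs_asym[OF assms(1), of a b] show False by simp
qed

lemma dominant_trans:
  "dominant V E S \<Longrightarrow> dominant S (induced_arcs E S) S' \<Longrightarrow> dominant V E S'"
  unfolding dominant_def by blast

lemma dominant_induced:
  "dominant V E S \<Longrightarrow> dominant V E S' \<Longrightarrow> S' \<subseteq> S \<Longrightarrow> dominant S (induced_arcs E S) S'"
  unfolding dominant_def by blast

definition initial_component :: "'a set \<Rightarrow> 'a rel \<Rightarrow> 'a set \<Rightarrow> bool" where
  "initial_component V E S \<longleftrightarrow> dominant V E S \<and> induced_arcs E S \<in> irreducible_arcs S"

text \<open>
  A dominant set of least size is irreducible, since dominance is transitive under restriction.
\<close>

lemma initial_component_exists:
  assumes E: "E \<in> tournament_arcs V" and V: "finite V" "V \<noteq> {}"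
  obtains S where "initial_component V E S"
proof -
  have "dominant V E V" using V by (auto simp: dominant_def)
  then obtain S where S: "dominant V E S" "\<And>S'. dominant V E S' \<Longrightarrow> card S \<le> card S'"
    using ex_has_least_nat[of "dominant V E" V card] by blast
  have fin: "finite S" using S(1) V(1) by (auto simp: dominant_def dest: finite_subset)
  have "S' = S" if "dominant S (induced_arcs E S) S'" for S'
  proof (rule card_seteq[OF fin])
    show "S' \<subseteq> S" using that by (simp add: dominant_def)
    show "card S \<le> card S'" using S(2)[OF dominant_trans[OF S(1) that]] .
  qed
  then have "initial_component V E S"
    using S(1) tournament_arcs_induced[OF E, of S]
    by (auto simp: initial_component_def irreducible_arcs_def dominant_def)
  then show ?thesis by (rule that)
qed

text \<open>
  By linearity one of two initial components contains the other; the smaller is then dominant inside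
  the larger, and irreducibility of the larger forces equality.
\<close>

lemma initial_component_unique:
  assumes "E \<in> tournament_arcs V" "initial_component V E S" "initial_component V E S'"
  shows "S = S'"
proof -
  have *: "S' = S" if "S' \<subseteq> S" "initial_component V E S" "initial_component V E S'" for S S'
    using that dominant_induced[of V E S S'] by (auto simp: initial_component_def irreducible_arcs_def)
  have "S \<subseteq> S' \<or> S' \<subseteq> S"
    using assms by (intro dominant_linear) (auto simp: initial_component_def)
  with * assms(2,3) show ?thesis by metis
qed

section \<open>Counting by the initial component\<close>

text \<open>
  A tournament in which \<open>S\<close> dominates the other vertices is the same as a pair of tournaments, one
  on \<open>S\<close> and one on the complement: the arcs between the two parts are forced.
\<close>

lemma card_dominated_pairs:
  assumes S: "S \<subseteq> V" and A: "A \<subseteq> tournament_arcs S" and B: "B \<subseteq> tournament_arcs (V - S)"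
  shows "card {E \<in> tournament_arcs V. S \<times> (V - S) \<subseteq> E \<and> induced_arcs E S \<in> A \<and>
            induced_arcs E (V - S) \<in> B} = card A * card B" (is "card ?X = _")
proof -
  let ?f = "\<lambda>(E1, E2). E1 \<union> E2 \<union> S \<times> (V - S)"
  let ?g = "\<lambda>E. (induced_arcs E S, induced_arcs E (V - S))"
  have gf: "?g (?f (E1, E2)) = (E1, E2)" if "E1 \<in> A" "E2 \<in> B" for E1 E2
    using that A B tournament_arcs_sub[of E1 S] tournament_arcs_sub[of E2 "V - S"] by auto
  have fX: "?f (E1, E2) \<in> ?X" if *: "E1 \<in> A" "E2 \<in> B" for E1 E2
  proof -
    have 1: "E1 \<in> tournament_arcs S" "E2 \<in> tournament_arcs (V - S)" using * A B by auto
    note sub = tournament_arcs_sub[OF 1(1)] tournament_arcs_sub[OF 1(2)]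
    have "?f (E1, E2) \<in> tournament_arcs V"
    proof (rule tournament_arcsI)
      show "?f (E1, E2) \<subseteq> V \<times> V" using S sub by auto
      show "(v, u) \<notin> ?f (E1, E2)" if "(u, v) \<in> ?f (E1, E2)" for u v
        using that sub tournament_arcs_asym[OF 1(1), of u v] tournament_arcs_asym[OF 1(2), of u v] by auto
      show "(v, u) \<in> ?f (E1, E2)" if "u \<in> V" "v \<in> V" "u \<noteq> v" "(u, v) \<notin> ?f (E1, E2)" for u v
        using that tournament_arcs_total[OF 1(1), of v u] tournament_arcs_total[OF 1(2), of v u]
        by auto
    qed
    moreover have "S \<times> (V - S) \<subseteq> ?f (E1, E2)" by simp
    moreover have "induced_arcs (?f (E1, E2)) S = E1" "induced_arcs (?f (E1, E2)) (V - S) = E2"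
      using gf[OF *] by simp_all
    ultimately show ?thesis using * by simp
  qed
  have fg: "?f (?g E) = E" if "E \<in> ?X" for E
  proof -
    have E: "E \<in> tournament_arcs V" and dom: "S \<times> (V - S) \<subseteq> E" using that by auto
    have "u \<in> S" if "(u, v) \<in> E" "v \<in> S" for u v
      using that dom tournament_arcs_asym[OF E, of u v] tournament_arcs_sub[OF E] by blast
    with tournament_arcs_sub[OF E] dom S show ?thesis by auto
  qed
  have "bij_betw ?f (A \<times> B) ?X"
    by (rule bij_betw_byWitness[where f' = ?g]) (use gf fX fg in auto)
  then show ?thesis by (simp add: card_cartesian_product bij_betw_same_card[symmetric])
qed

lemma sum_Pow_card:
  fixes f :: "nat \<Rightarrow> 'b::comm_semiring_1"
  assumes "finite V"
  shows "(\<Sum>S\<in>Pow V. f (card S)) = (\<Sum>k\<le>card V. of_nat (card V choose k) * f k)"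
proof -
  have "(\<Sum>S\<in>Pow V. f (card S)) = (\<Sum>k\<le>card V. \<Sum>S\<in>{S \<in> Pow V. card S = k}. f (card S))"
    by (rule sum.group[symmetric]) (use assms in \<open>auto intro: card_mono\<close>)
  also have "\<dots> = (\<Sum>k\<le>card V. of_nat (card V choose k) * f k)"
    using n_subsets[OF assms] by (intro sum.cong) (auto simp: mult.commute)
  finally show ?thesis .
qed

text \<open>
  Inserting a vertex \<open>x\<close> amounts to choosing freely the set \<open>A\<close> of its successors.
\<close>

lemma card_tournament_arcs:
  assumes "finite V"
  shows "card (tournament_arcs V) = 2 ^ (card V choose 2)"
  using assms
proof (induction V rule: finite_induct)
  case empty
  have "tournament_arcs {} = {{} :: 'a rel}"
    by (auto simp: tournament_arcs_def)
  then show ?case by (simp add: binomial_eq_0)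
next
  case (insert x V)
  let ?T = "tournament_arcs (insert x V)"
  let ?f = "\<lambda>(E, A). E \<union> {x} \<times> A \<union> (V - A) \<times> {x}"
  let ?g = "\<lambda>E. (induced_arcs E V, {u \<in> V. (x, u) \<in> E})"
  have gf: "?g (?f (E, A)) = (E, A)" if "E \<in> tournament_arcs V" "A \<subseteq> V" for E A
    using that insert.hyps(2) tournament_arcs_sub[of E V] by auto
  have fX: "?f (E, A) \<in> ?T" if *: "E \<in> tournament_arcs V" "A \<subseteq> V" for E A
  proof (rule tournament_arcsI)
    show "?f (E, A) \<subseteq> insert x V \<times> insert x V" using * tournament_arcs_sub[of E V] by auto
    show "(v, u) \<notin> ?f (E, A)" if "(u, v) \<in> ?f (E, A)" for u v
      using that * insert.hyps(2) tournament_arcs_sub[OF *(1)] tournament_arcs_asym[OF *(1), of u v] by auto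
    show "(v, u) \<in> ?f (E, A)"
      if "u \<in> insert x V" "v \<in> insert x V" "u \<noteq> v" "(u, v) \<notin> ?f (E, A)" for u v
      using that tournament_arcs_total[OF *(1), of v u] by auto
  qed
  have fg: "?f (?g E) = E" if E: "E \<in> ?T" for E
  proof -
    have "E \<subseteq> insert x V \<times> insert x V" "(x, x) \<notin> E"
      using tournament_arcs_sub[OF E] tournament_arcs_asym[OF E, of x x] by blast+
    moreover have "(u, x) \<in> E \<longleftrightarrow> (x, u) \<notin> E" if "u \<in> V" for u
      using that tournament_arcs_total[OF E, of u x] tournament_arcs_asym[OF E, of u x] insert.hyps(2)
      by auto
    ultimately show ?thesis by auto
  qed
  have "?g E \<in> tournament_arcs V \<times> Pow V" if "E \<in> ?T" for E
    using tournament_arcs_induced[OF that, of V] by auto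
  then have "bij_betw ?f (tournament_arcs V \<times> Pow V) ?T"
    by (intro bij_betw_byWitness[where f' = ?g]) (use gf fX fg in auto)
  then have "card ?T = card (tournament_arcs V \<times> Pow V)" by (simp add: bij_betw_same_card)
  also have "\<dots> = 2 ^ (card V choose 2) * 2 ^ card V"
    using insert by (simp add: card_cartesian_product card_Pow)
  also have "\<dots> = 2 ^ (card (insert x V) choose 2)"
    using insert.hyps by (simp add: numeral_2_eq_2 power_add[symmetric] add.commute)
  finally show ?case .
qed

abbreviation num_tournaments :: "nat \<Rightarrow> nat" where
  "num_tournaments n \<equiv> 2 ^ (n choose 2)"

text \<open>
  Uniqueness of the initial component makes the classes of tournaments with a given one disjoint.
  The set function \<open>Q\<close> prescribes what may remain: an arbitrary tournament for the recurrence of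
  \<open>t\<^sub>n\<close>, an irreducible one for tournaments with two components.
\<close>

lemma card_by_initial_component:
  assumes V: "finite V" and Q: "\<And>W. Q W \<subseteq> tournament_arcs W"
  shows "card {E \<in> tournament_arcs V. \<exists>S. initial_component V E S \<and> induced_arcs E (V - S) \<in> Q (V - S)} =
    (\<Sum>S\<in>Pow V. card (irreducible_arcs S) * card (Q (V - S)))"
proof -
  let ?X = "\<lambda>S. {E \<in> tournament_arcs V. S \<times> (V - S) \<subseteq> E \<and> induced_arcs E S \<in> irreducible_arcs S \<and>
            induced_arcs E (V - S) \<in> Q (V - S)}"
  have X: "?X S = {E \<in> tournament_arcs V. initial_component V E S \<and> induced_arcs E (V - S) \<in> Q (V - S)}"
    if "S \<subseteq> V" for S
    using that by (auto simp: initial_component_def dominant_def dest: irreducible_arcs_nonempty)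
  have "{E \<in> tournament_arcs V. \<exists>S. initial_component V E S \<and> induced_arcs E (V - S) \<in> Q (V - S)} =
      (\<Union>S\<in>Pow V. ?X S)"
  proof (intro equalityI subsetI)
    fix E assume "E \<in> {E \<in> tournament_arcs V. \<exists>S. initial_component V E S \<and> induced_arcs E (V - S) \<in> Q (V - S)}"
    then obtain S where S: "E \<in> tournament_arcs V" "initial_component V E S"
        "induced_arcs E (V - S) \<in> Q (V - S)" by blast
    then have "S \<subseteq> V" by (simp add: initial_component_def dominant_def)
    with S X show "E \<in> (\<Union>S\<in>Pow V. ?X S)" by blast
  next
    fix E assume "E \<in> (\<Union>S\<in>Pow V. ?X S)"
    then obtain S where "S \<subseteq> V" "E \<in> ?X S" by blast
    then show "E \<in> {E \<in> tournament_arcs V. \<exists>S. initial_component V E S \<and> induced_arcs E (V - S) \<in> Q (V - S)}"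
      using X by blast
  qed
  moreover have "card (\<Union>S\<in>Pow V. ?X S) = (\<Sum>S\<in>Pow V. card (?X S))"
  proof (rule card_UN_disjoint)
    show "\<forall>S\<in>Pow V. finite (?X S)"
      using tournament_arcs_finite[OF V] by simp
    show "\<forall>S\<in>Pow V. \<forall>S'\<in>Pow V. S \<noteq> S' \<longrightarrow> ?X S \<inter> ?X S' = {}"
    proof (intro ballI impI)
      fix S S' assume *: "S \<in> Pow V" "S' \<in> Pow V" "S \<noteq> S'"
      with initial_component_unique[of _ V S S'] show "?X S \<inter> ?X S' = {}"
        by (subst (1 2) X) auto
    qed
  qed (use V in simp)
  moreover have "(\<Sum>S\<in>Pow V. card (?X S)) = (\<Sum>S\<in>Pow V. card (irreducible_arcs S) * card (Q (V - S)))"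
    using Q by (intro sum.cong refl card_dominated_pairs) (simp_all add: irreducible_arcs_subset)
  ultimately show ?thesis by simp
qed

lemma num_tournaments_by_initial_component:
  assumes V: "finite V" "V \<noteq> {}"
  shows "num_tournaments (card V) =
    (\<Sum>S\<in>Pow V. card (irreducible_arcs S) * num_tournaments (card V - card S))"
proof -
  have "{E \<in> tournament_arcs V. \<exists>S. initial_component V E S \<and>
      induced_arcs E (V - S) \<in> tournament_arcs (V - S)} = tournament_arcs V"
  proof (intro equalityI subsetI)
    fix E assume E: "E \<in> tournament_arcs V"
    obtain S where "initial_component V E S"
      using initial_component_exists[OF E V] .
    with E tournament_arcs_induced[OF E, of "V - S"]
    show "E \<in> {E \<in> tournament_arcs V. \<exists>S. initial_component V E S \<and>
        induced_arcs E (V - S) \<in> tournament_arcs (V - S)}" by blast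
  qed blast
  then have "card (tournament_arcs V) =
      (\<Sum>S\<in>Pow V. card (irreducible_arcs S) * card (tournament_arcs (V - S)))"
    using card_by_initial_component[OF V(1), of tournament_arcs] by simp
  also have "\<dots> = (\<Sum>S\<in>Pow V. card (irreducible_arcs S) * num_tournaments (card V - card S))"
    using V(1) by (intro sum.cong refl) (auto simp: card_tournament_arcs card_Diff_subset finite_subset)
  finally show ?thesis using card_tournament_arcs[OF V(1)] by simp
qed

text \<open>
  The number of irreducible tournaments depends only on the number of vertices. Rather than by
  relabelling, this follows by induction: the recurrence determines the number from those for
  smaller sets and from the number of all tournaments, which is explicit.
\<close>

lemma card_irreducible_arcs_cong:
  fixes V :: "nat set"
  assumes "finite V"
  shows "card (irreducible_arcs V) = card (irreducible_arcs {1..card V})"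
  using assms
proof (induction "card V" arbitrary: V rule: less_induct)
  case less
  define a where "a k = card (irreducible_arcs {1..k})" for k :: nat
  define n where "n = card V"
  let ?F = "\<Sum>k\<le>n. (n choose k) * (a k * num_tournaments (n - k))"
  (* The summand of the full set W itself is replaced by a n on the right; adding a n on the left
     compensates for it and avoids subtraction of natural numbers. *)
  have key: "num_tournaments n + a n = card (irreducible_arcs W) + ?F"
    if W: "finite W" "W \<noteq> {}" "card W = n" for W :: "nat set"
  proof -
    have smaller: "card (irreducible_arcs S) = a (card S)" if "S \<in> Pow W - {W}" for S
    proof -
      have "S \<subset> W" using that by blast
      then have "card S < card V" "finite S"
        using W psubset_card_mono[of W S] finite_subset[of S W] by (auto simp: n_def)
      then show ?thesis unfolding a_def by (rule less.hyps)
    qed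
    have "num_tournaments n = (\<Sum>S\<in>Pow W. card (irreducible_arcs S) * num_tournaments (n - card S))"
      using num_tournaments_by_initial_component[OF W(1,2)] W(3) by simp
    also have "\<dots> = card (irreducible_arcs W) +
        (\<Sum>S\<in>Pow W - {W}. card (irreducible_arcs S) * num_tournaments (n - card S))"
      using W by (subst sum.remove[of _ W]) (auto simp: numeral_2_eq_2)
    also have "(\<Sum>S\<in>Pow W - {W}. card (irreducible_arcs S) * num_tournaments (n - card S)) =
        (\<Sum>S\<in>Pow W - {W}. a (card S) * num_tournaments (n - card S))"
      using smaller by (intro sum.cong) auto
    finally have "num_tournaments n + a n = card (irreducible_arcs W) +
        (\<Sum>S\<in>Pow W. a (card S) * num_tournaments (n - card S))"
      using W by (subst sum.remove[of _ W]) (auto simp: numeral_2_eq_2)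
    then show ?thesis
      using sum_Pow_card[OF W(1), of "\<lambda>k. a k * num_tournaments (n - k)"] W(3) by simp
  qed
  show ?case
  proof (cases "V = {}")
    case False
    with less.prems have "{1..n} \<noteq> {}" by (auto simp: n_def Suc_le_eq card_gt_0_iff)
    then have "card (irreducible_arcs V) = card (irreducible_arcs {1..n})"
      using key[of V] key[of "{1..n}"] less.prems False by (simp add: n_def[symmetric])
    then show ?thesis by (simp add: n_def)
  qed simp
qed

section \<open>Strongly connected components\<close>

text \<open>
  The classes of mutual reachability, in other words the vertex sets of the strongly connected components.
\<close>

definition strong_classes :: "'a set \<Rightarrow> 'a rel \<Rightarrow> 'a set set" where
  "strong_classes V E = {S. S \<noteq> {} \<and> S \<subseteq> V \<and> (\<forall>u\<in>S. \<forall>v\<in>S. (u, v) \<in> E\<^sup>*) \<and>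
     (\<forall>u\<in>S. \<forall>v\<in>V - S. (u, v) \<notin> E\<^sup>* \<or> (v, u) \<notin> E\<^sup>*)}"

lemma strong_classes_disjoint:
  assumes "S \<in> strong_classes V E" "S' \<in> strong_classes V E" "S \<inter> S' \<noteq> {}"
  shows "S = S'"
proof -
  have sub: "S \<subseteq> S'"
    if S: "S \<in> strong_classes V E" and S': "S' \<in> strong_classes V E" and x: "x \<in> S" "x \<in> S'" for S S' x
  proof (rule subsetI, rule ccontr)
    fix y assume y: "y \<in> S" "y \<notin> S'"
    have "(x, y) \<in> E\<^sup>*" "(y, x) \<in> E\<^sup>*" "y \<in> V"
      using S x(1) y(1) by (auto simp: strong_classes_def)
    with S' x(2) y(2) show False by (simp add: strong_classes_def)
  qed
  obtain x where "x \<in> S" "x \<in> S'" using assms(3) by blast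
  with sub assms(1,2) show ?thesis by (meson subset_antisym)
qed

lemma strong_classes_cover:
  assumes "v \<in> V"
  obtains S where "S \<in> strong_classes V E" "v \<in> S"
proof -
  have "{u \<in> V. (u, v) \<in> E\<^sup>* \<and> (v, u) \<in> E\<^sup>*} \<in> strong_classes V E"
    using assms unfolding strong_classes_def by (auto intro: rtrancl_trans)
  with assms that show ?thesis by blast
qed

lemma dominant_not_entered:
  assumes "E \<in> tournament_arcs V" "dominant V E S" "(x, y) \<in> E\<^sup>*" "x \<notin> S"
  shows "y \<notin> S"
  using assms(3,4)
proof (induction rule: rtrancl_induct)
  case (step y z)
  show ?case
  proof
    assume "z \<in> S"
    moreover have "y \<in> V - S" using step assms(1) tournament_arcs_sub by blast
    ultimately have "(z, y) \<in> E" using assms(2) by (auto simp: dominant_def)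
    with step tournament_arcs_asym[OF assms(1), of y z] show False by blast
  qed
qed

text \<open>
  The vertices from which \<open>v\<close> can be reached have no arc coming in from outside, so they form a
  dominant set.
\<close>

lemma irreducible_arcs_connected:
  assumes E: "E \<in> irreducible_arcs V" and "u \<in> V" "v \<in> V"
  shows "(u, v) \<in> E\<^sup>*"
proof -
  let ?A = "{w \<in> V. (w, v) \<in> E\<^sup>*}"
  have ET: "E \<in> tournament_arcs V" using E by (simp add: irreducible_arcs_def)
  have "(a, w) \<in> E" if "a \<in> ?A" "w \<in> V - ?A" for a w
    using that tournament_arcs_total[OF ET, of a w] by (auto intro: converse_rtrancl_into_rtrancl)
  then have "dominant V E ?A" using assms(3) unfolding dominant_def by blast
  with E have "?A = V" unfolding irreducible_arcs_def by blast
  with assms(2) show ?thesis by blast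
qed

lemma initial_component_strong_class:
  assumes "E \<in> tournament_arcs V" "initial_component V E S"
  shows "S \<in> strong_classes V E"
proof -
  have S: "dominant V E S" "induced_arcs E S \<in> irreducible_arcs S"
    using assms(2) by (auto simp: initial_component_def)
  have "(u, v) \<in> E\<^sup>*" if "u \<in> S" "v \<in> S" for u v
    using irreducible_arcs_connected[OF S(2) that] rtrancl_mono[of "induced_arcs E S" E] by blast
  moreover have "(v, u) \<notin> E\<^sup>*" if "u \<in> S" "v \<in> V - S" for u v
    using dominant_not_entered[OF assms(1) S(1), of v u] that by blast
  ultimately show ?thesis
    using S(1) by (simp add: strong_classes_def dominant_def)
qed

text \<open>
  The initial component is always one of the classes. If there is just one more, it is the complement;
  a dominant subset of the complement would, together with the initial component, be a dominant set
  that the rest of the complement cannot enter, so it must be the whole complement.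
\<close>

lemma two_strong_classes_iff:
  assumes E: "E \<in> tournament_arcs V" and V: "finite V" "V \<noteq> {}"
  shows "card (strong_classes V E) = 2 \<longleftrightarrow>
    (\<exists>S. initial_component V E S \<and> induced_arcs E (V - S) \<in> irreducible_arcs (V - S))"
proof
  assume "card (strong_classes V E) = 2"
  moreover obtain S where S: "initial_component V E S"
    using initial_component_exists[OF E V] .
  note Sc = initial_component_strong_class[OF E S]
  ultimately have "card (strong_classes V E - {S}) = 1" by simp
  then obtain Y where "strong_classes V E - {S} = {Y}" by (auto simp: card_1_singleton_iff)
  with Sc have Y: "strong_classes V E = {S, Y}" "Y \<noteq> S" by blast+
  have dom: "dominant V E S" using S by (simp add: initial_component_def)
  have "Y = V - S"
  proof
    have YC: "Y \<in> strong_classes V E" using Y(1) by simp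
    then have "Y \<inter> S = {}" using strong_classes_disjoint[OF YC Sc] Y(2) by blast
    moreover have "Y \<subseteq> V" using YC unfolding strong_classes_def by simp
    ultimately show "Y \<subseteq> V - S" by blast
    show "V - S \<subseteq> Y"
    proof
      fix v assume v: "v \<in> V - S"
      then obtain X where "X \<in> strong_classes V E" "v \<in> X" using strong_classes_cover by (metis DiffD1)
      with v Y(1) show "v \<in> Y" by auto
    qed
  qed
  with Y(1) have Y: "V - S \<in> strong_classes V E" by simp
  have "S' = V - S" if S': "dominant (V - S) (induced_arcs E (V - S)) S'" for S'
  proof (rule ccontr)
    assume "S' \<noteq> V - S"
    with S' obtain w s where ws: "w \<in> V - S" "w \<notin> S'" "s \<in> S'" "s \<in> V - S"
      unfolding dominant_def by blast
    have "dominant V E (S \<union> S')" using S' dom unfolding dominant_def by blast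
    moreover have "(w, s) \<in> E\<^sup>*" using Y ws by (auto simp: strong_classes_def)
    ultimately have "s \<notin> S \<union> S'" using dominant_not_entered[OF E] ws by blast
    with ws show False by blast
  qed
  moreover have "V - S \<noteq> {}" using Y by (auto simp: strong_classes_def)
  ultimately have "induced_arcs E (V - S) \<in> irreducible_arcs (V - S)"
    using tournament_arcs_induced[OF E, of "V - S"] by (auto simp: irreducible_arcs_def)
  with S show "\<exists>S. initial_component V E S \<and> induced_arcs E (V - S) \<in> irreducible_arcs (V - S)"
    by blast
next
  assume "\<exists>S. initial_component V E S \<and> induced_arcs E (V - S) \<in> irreducible_arcs (V - S)"
  then obtain S where S: "initial_component V E S"
    and R: "induced_arcs E (V - S) \<in> irreducible_arcs (V - S)" by blast
  have dom: "dominant V E S" using S by (simp add: initial_component_def)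
  have Sc: "S \<in> strong_classes V E" by (rule initial_component_strong_class[OF E S])
  have "(u, v) \<in> E\<^sup>*" if "u \<in> V - S" "v \<in> V - S" for u v
    using irreducible_arcs_connected[OF R that] rtrancl_mono[of "induced_arcs E (V - S)" E] by blast
  moreover have "V - S \<noteq> {}" by (rule irreducible_arcs_nonempty[OF R])
  ultimately have Rc: "V - S \<in> strong_classes V E"
    using dominant_not_entered[OF E dom] unfolding strong_classes_def mem_Collect_eq
    by (intro conjI ballI) (blast | simp)+
  have "X = S \<or> X = V - S" if X: "X \<in> strong_classes V E" for X
  proof -
    have "X \<noteq> {}" "X \<subseteq> V" using X by (simp_all add: strong_classes_def)
    then have "X \<inter> S \<noteq> {} \<or> X \<inter> (V - S) \<noteq> {}" by blast
    then show ?thesis using strong_classes_disjoint[OF X Sc] strong_classes_disjoint[OF X Rc] by metis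
  qed
  with Sc Rc have "strong_classes V E = {S, V - S}" by blast
  moreover have "S \<noteq> {}" using dom by (simp add: dominant_def)
  then have "S \<noteq> V - S" by (metis Diff_disjoint inf.idem)
  ultimately show "card (strong_classes V E) = 2" by simp
qed

lemma num_two_strong_classes:
  assumes V: "finite V" "V \<noteq> {}"
  shows "card {E \<in> tournament_arcs V. card (strong_classes V E) = 2} =
    (\<Sum>S\<in>Pow V. card (irreducible_arcs S) * card (irreducible_arcs (V - S)))"
proof -
  have "{E \<in> tournament_arcs V. card (strong_classes V E) = 2} =
      {E \<in> tournament_arcs V. \<exists>S. initial_component V E S \<and>
        induced_arcs E (V - S) \<in> irreducible_arcs (V - S)}"
    using two_strong_classes_iff[OF _ V] by blast
  then show ?thesis
    using card_by_initial_component[OF V(1) irreducible_arcs_subset] by simp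
qed

section \<open>Transfer to labeled tournaments\<close>

lemma tournament_iff_arcs:
  "tournament T \<longleftrightarrow> finite (pverts T) \<and> parcs T \<in> tournament_arcs (pverts T)"
proof
  assume T: "tournament T"
  then interpret pair_digraph T by (simp add: tournament_def)
  have iff: "(u, v) \<in> parcs T \<longleftrightarrow> (v, u) \<notin> parcs T"
    if "u \<in> pverts T" "v \<in> pverts T" "u \<noteq> v" for u v
    using conjunct2[OF T[unfolded tournament_def], rule_format, OF that] .
  have "parcs T \<in> tournament_arcs (pverts T)"
  proof (rule tournament_arcsI)
    show "parcs T \<subseteq> pverts T \<times> pverts T" using in_arcsD1 in_arcsD2 by auto
    show "(v, u) \<notin> parcs T" if "(u, v) \<in> parcs T" for u v
      using that iff[OF in_arcsD1[OF that] in_arcsD2[OF that]] no_loops' by metis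
    show "(v, u) \<in> parcs T" if "u \<in> pverts T" "v \<in> pverts T" "u \<noteq> v" "(u, v) \<notin> parcs T" for u v
      using iff[OF that(1-3)] that(4) by simp
  qed
  then show "finite (pverts T) \<and> parcs T \<in> tournament_arcs (pverts T)"
    using pair_finite_verts by simp
next
  assume *: "finite (pverts T) \<and> parcs T \<in> tournament_arcs (pverts T)"
  then have fin: "finite (pverts T)" and T: "parcs T \<in> tournament_arcs (pverts T)" by auto
  note sub = tournament_arcs_sub[OF T]
  have "finite (parcs T)" using sub fin by (auto intro: finite_subset)
  moreover have "(u, u) \<notin> parcs T" for u
    using tournament_arcs_asym[OF T, of u u] by blast
  ultimately have "pair_digraph T"
    using fin sub
    by (intro pair_digraph.intro pair_fin_digraph.intro pair_wf_digraph.intro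
        pair_loopfree_digraph.intro pair_fin_digraph_axioms.intro
        pair_loopfree_digraph_axioms.intro) auto
  moreover have "(u, v) \<in> parcs T \<longleftrightarrow> (v, u) \<notin> parcs T"
    if "u \<in> pverts T" "v \<in> pverts T" "u \<noteq> v" for u v
    using tournament_arcs_asym[OF T, of u v] tournament_arcs_total[OF T that] by blast
  ultimately show "tournament T" unfolding tournament_def by blast
qed

text \<open>
  Between the parts of a partition, lacking an arc in one direction means having all arcs in
  the other, so only one of the two cut conditions has to be tested.
\<close>

lemma irreducible_tournament_iff_arcs:
  assumes "tournament T"
  shows "irreducible_tournament T \<longleftrightarrow> parcs T \<in> irreducible_arcs (pverts T)"
proof -
  define V E where "V = pverts T" and "E = parcs T"
  have E: "E \<in> tournament_arcs V" using assms by (simp add: tournament_iff_arcs V_def E_def)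
  have dom: "dominant V E A \<longleftrightarrow> \<not> (\<exists>a\<in>A. \<exists>b\<in>B. (b, a) \<in> E)"
    if "A \<union> B = V" "A \<inter> B = {}" "A \<noteq> {}" for A B
  proof
    show "\<not> (\<exists>a\<in>A. \<exists>b\<in>B. (b, a) \<in> E)" if "dominant V E A"
    proof
      assume "\<exists>a\<in>A. \<exists>b\<in>B. (b, a) \<in> E"
      then obtain a b where ab: "a \<in> A" "b \<in> B" "(b, a) \<in> E" by blast
      with that \<open>A \<union> B = V\<close> \<open>A \<inter> B = {}\<close> have "(a, b) \<in> E" unfolding dominant_def by blast
      with tournament_arcs_asym[OF E, of a b] ab(3) show False by simp
    qed
    assume *: "\<not> (\<exists>a\<in>A. \<exists>b\<in>B. (b, a) \<in> E)"
    have "(a, b) \<in> E" if "a \<in> A" "b \<in> V - A" for a b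
    proof (rule tournament_arcs_total[OF E])
      show "a \<in> V" "b \<in> V" "a \<noteq> b" using that \<open>A \<union> B = V\<close> by auto
      show "(b, a) \<notin> E" using that * \<open>A \<union> B = V\<close> by blast
    qed
    with \<open>A \<union> B = V\<close> \<open>A \<noteq> {}\<close> show "dominant V E A" unfolding dominant_def by auto
  qed
  have "(\<forall>A B. A \<union> B = V \<and> A \<inter> B = {} \<and> A \<noteq> {} \<and> B \<noteq> {} \<longrightarrow>
       (\<exists>a \<in> A. \<exists>b \<in> B. (a, b) \<in> E) \<and> (\<exists>a \<in> A. \<exists>b \<in> B. (b, a) \<in> E)) \<longleftrightarrow>
       (\<forall>S. dominant V E S \<longrightarrow> S = V)" (is "?L \<longleftrightarrow> ?R")
  proof
    assume L: ?L
    show ?R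
    proof (intro allI impI, rule ccontr)
      fix S assume S: "dominant V E S" "S \<noteq> V"
      then have *: "S \<union> (V - S) = V" "S \<inter> (V - S) = {}" "S \<noteq> {}" "V - S \<noteq> {}"
        by (auto simp: dominant_def)
      with L have "\<exists>a\<in>S. \<exists>b\<in>V - S. (b, a) \<in> E" by blast
      with dom[OF *(1-3)] S(1) show False by blast
    qed
  next
    assume R: ?R
    have one: "\<exists>a\<in>A. \<exists>b\<in>B. (b, a) \<in> E"
      if "A \<union> B = V" "A \<inter> B = {}" "A \<noteq> {}" "B \<noteq> {}" for A B
      using R dom[OF that(1-3)] that by blast
    show ?L
    proof (intro allI impI)
      fix A B assume "A \<union> B = V \<and> A \<inter> B = {} \<and> A \<noteq> {} \<and> B \<noteq> {}"
      then show "(\<exists>a \<in> A. \<exists>b \<in> B. (a, b) \<in> E) \<and> (\<exists>a \<in> A. \<exists>b \<in> B. (b, a) \<in> E)"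
        using one[of A B] one[of B A] by blast
    qed
  qed
  then show ?thesis using assms E
    unfolding irreducible_tournament_def irreducible_arcs_def V_def E_def by blast
qed

lemma card_irreducible_components:
  assumes "tournament T"
  shows "card (irreducible_components T) = card (strong_classes (pverts T) (parcs T))"
proof -
  interpret pair_digraph T using assms by (simp add: tournament_def)
  have reach: "u \<rightarrow>\<^sup>*\<^bsub>with_proj T\<^esub> v \<longleftrightarrow> u \<in> pverts T \<and> v \<in> pverts T \<and> (u, v) \<in> (parcs T)\<^sup>*" for u v
    by (auto simp: reachable_conv)
  have "sccs_verts = strong_classes (pverts T) (parcs T)"
    unfolding sccs_verts_def strong_classes_def reach by blast
  then show ?thesis using card_sccs_verts by (simp add: irreducible_components_def)
qed

lemma bij_betw_parcs: "bij_betw parcs (labeled_tournaments n) (tournament_arcs {1..n})"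
  by (rule bij_betw_byWitness[where f' = "\<lambda>E. \<lparr>pverts = {1..n}, parcs = E\<rparr>"])
    (auto simp: labeled_tournaments_def tournament_iff_arcs)

lemma card_labeled_tournaments_Collect:
  assumes "\<And>T. T \<in> labeled_tournaments n \<Longrightarrow> P T \<longleftrightarrow> Q (parcs T)"
  shows "card {T \<in> labeled_tournaments n. P T} = card {E \<in> tournament_arcs {1..n}. Q E}"
proof -
  have "parcs ` {T \<in> labeled_tournaments n. P T} = {E \<in> tournament_arcs {1..n}. Q E}"
    using assms bij_betw_imp_surj_on[OF bij_betw_parcs[of n], symmetric] by auto
  moreover have "inj_on parcs {T \<in> labeled_tournaments n. P T}"
    using bij_betw_imp_inj_on[OF bij_betw_parcs[of n]] by (rule inj_on_subset) auto
  ultimately show ?thesis using card_image by fastforce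
qed

lemma card_labeled_tournaments: "card (labeled_tournaments n) = num_tournaments n"
  using bij_betw_same_card[OF bij_betw_parcs[of n]] by (simp add: card_tournament_arcs)

lemma card_irreducible_arcs:
  fixes V :: "nat set"
  assumes "finite V"
  shows "card (irreducible_arcs V) = num_irreducible (card V)"
proof -
  have "num_irreducible n = card {E \<in> tournament_arcs {1..n}. E \<in> irreducible_arcs {1..n}}" for n
    unfolding num_irreducible_def
    by (rule card_labeled_tournaments_Collect)
      (auto simp: labeled_tournaments_def irreducible_tournament_iff_arcs)
  moreover have "{E \<in> tournament_arcs {1..n}. E \<in> irreducible_arcs {1..n}} = irreducible_arcs {1..n}"
    for n :: nat by (auto simp: irreducible_arcs_def)
  ultimately show ?thesis using card_irreducible_arcs_cong[OF assms] by simp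
qed

lemma num_irreducible_0: "num_irreducible 0 = 0"
  using card_irreducible_arcs[of "{}"] by (simp add: irreducible_arcs_def)

lemma num_irreducible_le: "num_irreducible n \<le> num_tournaments n"
  unfolding num_irreducible_def card_labeled_tournaments[symmetric]
  by (intro card_mono finite_labeled_tournaments) auto

lemma num_tournaments_recurrence:
  assumes "n \<ge> 1"
  shows "num_tournaments n = (\<Sum>k\<le>n. (n choose k) * (num_irreducible k * num_tournaments (n - k)))"
proof -
  have "num_tournaments n =
      (\<Sum>S\<in>Pow {1..n}. card (irreducible_arcs S) * num_tournaments (n - card S))"
    using num_tournaments_by_initial_component[of "{1..n}"] assms by simp
  also have "\<dots> = (\<Sum>S\<in>Pow {1..n}. num_irreducible (card S) * num_tournaments (n - card S))"
    by (intro sum.cong refl) (use card_irreducible_arcs finite_subset in \<open>metis PowD finite_atLeastAtMost\<close>)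
  also have "\<dots> = (\<Sum>k\<le>n. (n choose k) * (num_irreducible k * num_tournaments (n - k)))"
    using sum_Pow_card[of "{1..n}" "\<lambda>k. num_irreducible k * num_tournaments (n - k)"] by simp
  finally show ?thesis .
qed

lemma num_two_components_convolution:
  "num_two_components n = (\<Sum>k\<le>n. (n choose k) * (num_irreducible k * num_irreducible (n - k)))"
proof (cases "n = 0")
  case True
  have "strong_classes {} E = {}" for E :: "nat rel" by (auto simp: strong_classes_def)
  then have "card (irreducible_components T) \<noteq> 2" if "T \<in> labeled_tournaments 0" for T
    using that by (auto simp: labeled_tournaments_def card_irreducible_components)
  then have "{T \<in> labeled_tournaments 0. card (irreducible_components T) = 2} = {}" by blast
  then have "num_two_components 0 = 0" by (metis card.empty num_two_components_def)
  with True show ?thesis by (simp add: num_irreducible_0)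
next
  case False
  have "num_two_components n = card {E \<in> tournament_arcs {1..n}. card (strong_classes {1..n} E) = 2}"
    unfolding num_two_components_def
    by (rule card_labeled_tournaments_Collect)
      (auto simp: labeled_tournaments_def card_irreducible_components)
  also have "\<dots> = (\<Sum>S\<in>Pow {1..n}. card (irreducible_arcs S) * card (irreducible_arcs ({1..n} - S)))"
    using False by (intro num_two_strong_classes) auto
  also have "\<dots> = (\<Sum>S\<in>Pow {1..n}. num_irreducible (card S) * num_irreducible (n - card S))"
  proof (intro sum.cong refl)
    fix S assume "S \<in> Pow {1..n}"
    then have "S \<subseteq> {1..n}" "finite S" by (auto dest: finite_subset)
    then show "card (irreducible_arcs S) * card (irreducible_arcs ({1..n} - S)) =
        num_irreducible (card S) * num_irreducible (n - card S)"
      by (simp add: card_irreducible_arcs card_Diff_subset)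
  qed
  also have "\<dots> = (\<Sum>k\<le>n. (n choose k) * (num_irreducible k * num_irreducible (n - k)))"
    using sum_Pow_card[of "{1..n}" "\<lambda>k. num_irreducible k * num_irreducible (n - k)"] by simp
  finally show ?thesis .
qed

lemma prob_irreducible_eq: "prob_irreducible n = real (num_irreducible n) / real (num_tournaments n)"
  unfolding prob_irreducible_def num_irreducible_def
  by (subst measure_pmf_of_set)
    (auto simp: labeled_tournaments_nonempty finite_labeled_tournaments card_labeled_tournaments
      Int_def)

section \<open>Exponential generating functions\<close>

text \<open>
  With \<open>T\<close> and \<open>I\<close> the exponential generating functions of all and of irreducible tournaments,
  the first recurrence reads \<open>T - 1 = I T\<close>, and the second says that \<open>I\<^sup>2\<close> counts the tournaments
  with two components. Hence the coefficients of the expansion, together with the leading \<open>1\<close>,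
  have generating function \<open>1 - 2 I + I\<^sup>2 = (1 - I)\<^sup>2\<close>.
\<close>

definition egf :: "(nat \<Rightarrow> real) \<Rightarrow> real fps" where
  "egf f = Abs_fps (\<lambda>n. f n / fact n)"

definition binomial_convolution :: "(nat \<Rightarrow> real) \<Rightarrow> (nat \<Rightarrow> real) \<Rightarrow> nat \<Rightarrow> real" where
  "binomial_convolution f g n = (\<Sum>k\<le>n. real (n choose k) * (f k * g (n - k)))"

lemma egf_binomial_convolution: "egf (binomial_convolution f g) = egf f * egf g"
proof (rule fps_ext)
  fix n
  have "binomial_convolution f g n / fact n = (\<Sum>k\<le>n. f k / fact k * (g (n - k) / fact (n - k)))"
    unfolding binomial_convolution_def sum_divide_distrib
    by (intro sum.cong refl) (simp add: binomial_fact)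
  then show "fps_nth (egf (binomial_convolution f g)) n = fps_nth (egf f * egf g) n"
    by (simp add: egf_def fps_mult_nth atLeast0AtMost)
qed

lemma egf_inject: "egf f = egf g \<longleftrightarrow> f = g"
  by (auto simp: egf_def fps_eq_iff fun_eq_iff)

lemma egf_add: "egf (\<lambda>n. f n + g n) = egf f + egf g"
  by (simp add: egf_def fps_eq_iff add_divide_distrib)

lemma egf_diff: "egf (\<lambda>n. f n - g n) = egf f - egf g"
  by (simp add: egf_def fps_eq_iff diff_divide_distrib)

lemma egf_one: "egf (\<lambda>n. if n = 0 then 1 else 0) = 1"
  by (auto simp: egf_def fps_eq_iff)

definition all_count :: "nat \<Rightarrow> real" where "all_count n = 2 ^ (n choose 2)"
definition irr_count :: "nat \<Rightarrow> real" where "irr_count n = real (num_irreducible n)"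
definition exp_coeff :: "nat \<Rightarrow> real" where
  "exp_coeff n = (if n = 0 then 1 else 0) - 2 * real (num_irreducible n) + real (num_two_components n)"

lemma binomial_convolution_irreducible:
  "binomial_convolution irr_count irr_count n = real (num_two_components n)"
  by (simp add: binomial_convolution_def irr_count_def num_two_components_convolution)

lemma binomial_convolution_irreducible_tournaments:
  "binomial_convolution irr_count all_count n = all_count n - (if n = 0 then 1 else 0)"
proof (cases "n = 0")
  case False
  then have "real (num_tournaments n) =
      real (\<Sum>k\<le>n. (n choose k) * (num_irreducible k * num_tournaments (n - k)))"
    using num_tournaments_recurrence[of n] by simp
  with False show ?thesis by (simp add: binomial_convolution_def irr_count_def all_count_def)
qed (simp add: binomial_convolution_def irr_count_def all_count_def num_irreducible_0 numeral_2_eq_2)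

text \<open>
  This is \<open>T (1 - I)\<^sup>2 = 1 - I\<close>, the identity behind the cancellation in the recurrence for the error.
\<close>

lemma binomial_convolution_tournaments_coeff:
  "binomial_convolution all_count exp_coeff n = (if n = 0 then 1 else 0) - irr_count n"
proof -
  let ?one = "\<lambda>n::nat. if n = 0 then 1 else 0 :: real"
  have "binomial_convolution irr_count all_count = (\<lambda>n. all_count n - ?one n)"
    by (simp add: fun_eq_iff binomial_convolution_irreducible_tournaments)
  then have T: "egf irr_count * egf all_count = egf all_count - 1"
    by (metis egf_binomial_convolution egf_diff egf_one)
  have "exp_coeff = (\<lambda>n. (?one n - irr_count n) - irr_count n + binomial_convolution irr_count irr_count n)"
    by (auto simp: exp_coeff_def binomial_convolution_irreducible irr_count_def fun_eq_iff)
  then have "egf exp_coeff = egf (\<lambda>n. (?one n - irr_count n) - irr_count n) + egf (binomial_convolution irr_count irr_count)"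
    using egf_add[of "\<lambda>n. (?one n - irr_count n) - irr_count n" "binomial_convolution irr_count irr_count"] by simp
  also have "egf (\<lambda>n. (?one n - irr_count n) - irr_count n) = 1 - egf irr_count - egf irr_count"
    using egf_diff[of "\<lambda>n. ?one n - irr_count n" irr_count] egf_diff[of ?one irr_count] egf_one by simp
  also have "1 - egf irr_count - egf irr_count + egf (binomial_convolution irr_count irr_count) = (1 - egf irr_count) * (1 - egf irr_count)"
    by (simp add: egf_binomial_convolution algebra_simps)
  finally have C: "egf exp_coeff = (1 - egf irr_count) * (1 - egf irr_count)" .
  have "egf all_count * egf exp_coeff = (egf all_count - egf irr_count * egf all_count) * (1 - egf irr_count)"
    unfolding C by (simp add: algebra_simps)
  also have "\<dots> = egf (\<lambda>n. ?one n - irr_count n)"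
    using egf_diff[of ?one irr_count] by (simp add: T egf_one)
  finally show ?thesis by (simp add: egf_binomial_convolution[symmetric] egf_inject)
qed

section \<open>Growth of the number of tournaments\<close>

lemma choose_two_add: "(a + b) choose 2 = (a choose 2) + (b choose 2) + a * b"
  by (induction b) (simp_all add: numeral_2_eq_2)

text \<open>
  Making two parts of fixed total size more unequal does not decrease the number of pairs inside the parts.
\<close>

lemma choose_two_convex:
  assumes "s \<le> k" "k \<le> n - s" "s \<le> n"
  shows "(k choose 2) + (n - k choose 2) \<le> (s choose 2) + (n - s choose 2)"
proof -
  obtain p where p: "k = s + p" using assms(1) le_Suc_ex by blast
  obtain q where q: "n - s = k + q" using assms(2) le_Suc_ex by blast
  have "n - k = s + q" using p q assms by linarith
  then show ?thesis unfolding q by (simp add: p choose_two_add algebra_simps)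
qed

lemma all_count_pos: "all_count n > 0" by (simp add: all_count_def)

lemma irr_count_bounds: "0 \<le> irr_count n" "irr_count n \<le> all_count n"
proof -
  have "real (num_irreducible n) \<le> real (num_tournaments n)"
    using num_irreducible_le by (simp only: of_nat_le_iff)
  then show "0 \<le> irr_count n" "irr_count n \<le> all_count n" by (simp_all add: irr_count_def all_count_def)
qed

text \<open>
  The ratio in which the expansion of the probability is written: dropping \<open>k\<close> vertices divides the
  number of tournaments by a power of two that is explicit in \<open>n\<close>.
\<close>

lemma all_count_ratio:
  assumes "k \<le> n"
  shows "all_count (n - k) / all_count n = 2 ^ (k * (k + 1) div 2) / 2 ^ (n * k)"
proof -
  obtain m where n: "n = m + k" using assms by (metis le_add_diff_inverse2)
  have "k * (k + 1) div 2 = (k choose 2) + k"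
    using choose_two[of "k + 1"] by (simp add: numeral_2_eq_2 mult.commute)
  moreover have "2 * (k choose 2) + k = k * k"
    by (induction k) (simp_all add: numeral_2_eq_2)
  ultimately have "(n - k choose 2) + n * k = (k * (k + 1) div 2) + (n choose 2)"
    by (simp add: n choose_two_add algebra_simps)
  then have "(2::real) ^ (n - k choose 2) * 2 ^ (n * k) = 2 ^ (k * (k + 1) div 2) * 2 ^ (n choose 2)"
    by (simp only: power_add[symmetric])
  then show ?thesis by (simp add: all_count_def divide_simps)
qed

section \<open>The asymptotic expansion\<close>

definition remainder :: "nat \<Rightarrow> nat \<Rightarrow> real" where
  "remainder r n = irr_count n - (\<Sum>k<r. exp_coeff k * real (n choose k) * all_count (n - k))"

text \<open>
  The part of the recurrence for \<open>t\<^sub>n\<close> in which both factors have at least \<open>r\<close> vertices.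
\<close>

definition middle :: "nat \<Rightarrow> nat \<Rightarrow> real" where
  "middle r n = (\<Sum>k=r..n-r. real (n choose k) * (irr_count k * all_count (n - k)))"

lemma sum_split_ends:
  fixes f :: "nat \<Rightarrow> real"
  assumes "2 * r \<le> n"
  shows "(\<Sum>k\<le>n. f k) = (\<Sum>k<r. f k) + (\<Sum>k=r..n-r. f k) + (\<Sum>j<r. f (n - j))"
proof -
  have ends: "(\<Sum>j<r. f (n - j)) = (\<Sum>k\<in>{n-r<..n}. f k)"
    by (rule sum.reindex_bij_witness[where i = "\<lambda>k. n - k" and j = "\<lambda>j. n - j"]) (use assms in auto)
  have "{..n} = ({..<r} \<union> {r..n-r}) \<union> {n-r<..n}" using assms by auto
  then have "(\<Sum>k\<le>n. f k) = (\<Sum>k\<in>({..<r} \<union> {r..n-r}) \<union> {n-r<..n}. f k)" by simp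
  also have "\<dots> = (\<Sum>k\<in>{..<r} \<union> {r..n-r}. f k) + (\<Sum>k\<in>{n-r<..n}. f k)"
    using assms by (intro sum.union_disjoint) auto
  also have "(\<Sum>k\<in>{..<r} \<union> {r..n-r}. f k) = (\<Sum>k<r. f k) + (\<Sum>k=r..n-r. f k)"
    by (intro sum.union_disjoint) auto
  finally show ?thesis by (simp add: ends)
qed

text \<open>
  The errors of lower order arise from expanding \<open>i\<^sub>n\<^sub>-\<^sub>j\<close> to order \<open>r - j\<close>. With the term \<open>j = 0\<close>
  included, the explicit terms with \<open>j + m = k\<close> carry the \<open>k\<close>th coefficient of \<open>T (1 - I)\<^sup>2\<close>, that
  is of \<open>1 - I\<close>; these cancel against the left-hand side \<open>t\<^sub>n\<close> and the terms with small \<open>k\<close>.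
\<close>

lemma remainder_recurrence:
  assumes r: "r \<ge> 1" and n: "2 * r \<le> n"
  shows "remainder r n = - middle r n -
    (\<Sum>j=1..<r. real (n choose j) * all_count j * remainder (r - j) (n - j))"
proof -
  let ?R = "\<lambda>j. real (n choose j) * all_count j * remainder (r - j) (n - j)"
  let ?head = "\<Sum>k<r. real (n choose k) * (irr_count k * all_count (n - k))"
  have n0: "n \<noteq> 0" using r n by auto
  have "all_count n = ?head + middle r n + (\<Sum>j<r. real (n choose (n - j)) * (irr_count (n - j) * all_count (n - (n - j))))"
    using binomial_convolution_irreducible_tournaments[of n] n0
      sum_split_ends[OF n, of "\<lambda>k. real (n choose k) * (irr_count k * all_count (n - k))"]
    by (simp add: binomial_convolution_def middle_def)
  also have "(\<Sum>j<r. real (n choose (n - j)) * (irr_count (n - j) * all_count (n - (n - j)))) =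
      (\<Sum>j<r. real (n choose j) * all_count j * irr_count (n - j))"
    using n by (intro sum.cong refl) (simp add: binomial_symmetric[symmetric])
  also have "\<dots> = (\<Sum>j<r. ?R j + (\<Sum>m<r - j. real (n choose j) * all_count j *
      (exp_coeff m * real ((n - j) choose m) * all_count (n - j - m))))"
    by (intro sum.cong refl) (simp add: remainder_def right_diff_distrib sum_distrib_left)
  also have "\<dots> = (\<Sum>j<r. ?R j) + (\<Sum>j<r. \<Sum>m<r - j. real (n choose j) * all_count j *
      (exp_coeff m * real ((n - j) choose m) * all_count (n - j - m)))"
    by (rule sum.distrib)
  (* Collect the terms with j + m = k; the binomial coefficients regroup as
     (n choose j) (n - j choose k - j) = (n choose k) (k choose j). *)
  also have "(\<Sum>j<r. \<Sum>m<r - j. real (n choose j) * all_count j *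
      (exp_coeff m * real ((n - j) choose m) * all_count (n - j - m))) =
      (\<Sum>k<r. \<Sum>j\<le>k. real (n choose j) * all_count j *
        (exp_coeff (k - j) * real ((n - j) choose (k - j)) * all_count (n - j - (k - j))))"
    by (subst sum.triangle_reindex[symmetric], subst sum.Sigma)
      (auto intro!: sum.cong)
  also have "\<dots> = (\<Sum>k<r. real (n choose k) * all_count (n - k) * binomial_convolution all_count exp_coeff k)"
  proof (intro sum.cong refl)
    fix k assume k: "k \<in> {..<r}"
    have term_eq: "real (n choose j) * all_count j *
        (exp_coeff (k - j) * real ((n - j) choose (k - j)) * all_count (n - j - (k - j))) =
      real (n choose k) * all_count (n - k) * (real (k choose j) * (all_count j * exp_coeff (k - j)))"
      if "j \<le> k" for j
    proof -
      have "real (n choose j) * real ((n - j) choose (k - j)) = real (n choose k) * real (k choose j)"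
        using choose_mult[of j k n] that k n by (simp flip: of_nat_mult)
      then show ?thesis using that by (simp add: algebra_simps)
    qed
    show "(\<Sum>j\<le>k. real (n choose j) * all_count j *
        (exp_coeff (k - j) * real ((n - j) choose (k - j)) * all_count (n - j - (k - j)))) =
        real (n choose k) * all_count (n - k) * binomial_convolution all_count exp_coeff k"
      unfolding binomial_convolution_def sum_distrib_left by (intro sum.cong refl term_eq) simp
  qed
  also have "\<dots> = (\<Sum>k<r. (if k = 0 then all_count n else 0) - real (n choose k) * (irr_count k * all_count (n - k)))"
    by (intro sum.cong refl) (simp add: binomial_convolution_tournaments_coeff algebra_simps)
  also have "\<dots> = all_count n - ?head"
    using r by (simp add: sum_subtractf)
  finally have "middle r n + (\<Sum>j<r. ?R j) = 0" by simp
  moreover have "(\<Sum>j<r. ?R j) = ?R 0 + (\<Sum>j=1..<r. ?R j)"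
    using r by (simp add: lessThan_atLeast0 sum.atLeast_Suc_lessThan)
  ultimately show ?thesis by (simp add: all_count_def numeral_2_eq_2)
qed

text \<open>
  The two end terms \<open>k = r\<close> and \<open>k = n - r\<close> have the stated order. By convexity each other term is
  at most the binomial coefficient times \<open>t\<^sub>s t\<^sub>n\<^sub>-\<^sub>s\<close> with \<open>s = r + 1\<close>. The binomial coefficients add
  up to at most \<open>2\<^sup>n\<close>, and since \<open>t\<^sub>n\<^sub>-\<^sub>r\<close> is \<open>t\<^sub>n\<^sub>-\<^sub>s\<close> times \<open>2\<close> to the power \<open>n - s\<close>, moving from \<open>r\<close> to
  \<open>r + 1\<close> gains as much as this crude estimate loses, up to the constant \<open>2\<^sup>s\<close>.
\<close>

lemma middle_bound:
  assumes n: "2 * r + 2 \<le> n"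
  shows "\<bar>middle r n\<bar> \<le> (2 * all_count r + 2 ^ (r + 1) * all_count (r + 1)) * (real n ^ r * all_count (n - r))"
proof -
  let ?g = "\<lambda>k. real (n choose k) * (all_count k * all_count (n - k))"
  let ?I = "{r + 1..n - (r + 1)}"
  have "0 \<le> middle r n"
    unfolding middle_def using irr_count_bounds all_count_pos
    by (intro sum_nonneg mult_nonneg_nonneg) (auto intro: less_imp_le)
  moreover have "middle r n \<le> (\<Sum>k=r..n-r. ?g k)"
    unfolding middle_def using irr_count_bounds all_count_pos
    by (intro sum_mono mult_left_mono mult_right_mono) (auto intro: less_imp_le)
  moreover have "(\<Sum>k=r..n-r. ?g k) = ?g r + ?g (n - r) + (\<Sum>k\<in>?I. ?g k)"
  proof -
    have "{r..n-r} = insert r (insert (n - r) ?I)" using n by auto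
    then have "(\<Sum>k=r..n-r. ?g k) = (\<Sum>k\<in>insert r (insert (n - r) ?I). ?g k)" by (rule arg_cong)
    also have "\<dots> = ?g r + (\<Sum>k\<in>insert (n - r) ?I. ?g k)"
      by (rule sum.insert) (use n in auto)
    also have "(\<Sum>k\<in>insert (n - r) ?I. ?g k) = ?g (n - r) + (\<Sum>k\<in>?I. ?g k)"
      by (rule sum.insert) (use n in auto)
    finally show ?thesis by simp
  qed
  moreover have "?g (n - r) = ?g r" using n by (simp add: binomial_symmetric[of r n])
  moreover have "?g r \<le> real n ^ r * (all_count r * all_count (n - r))"
    using binomial_le_pow[of r n] n all_count_pos
    by (intro mult_right_mono) (auto intro: less_imp_le simp flip: of_nat_power)
  moreover have "(\<Sum>k\<in>?I. ?g k) \<le> 2 ^ (r + 1) * all_count (r + 1) * all_count (n - r)"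
  proof -
    have "(\<Sum>k\<in>?I. ?g k) \<le> (\<Sum>k\<in>?I. real (n choose k) * (all_count (r + 1) * all_count (n - (r + 1))))"
    proof (intro sum_mono mult_left_mono)
      fix k assume "k \<in> ?I"
      then show "all_count k * all_count (n - k) \<le> all_count (r + 1) * all_count (n - (r + 1))"
        unfolding all_count_def power_add[symmetric] using n
        by (intro power_increasing choose_two_convex) auto
    qed simp
    also have "\<dots> = (\<Sum>k\<in>?I. real (n choose k)) * (all_count (r + 1) * all_count (n - (r + 1)))"
      by (simp add: sum_distrib_right)
    also have "\<dots> \<le> (\<Sum>k\<le>n. real (n choose k)) * (all_count (r + 1) * all_count (n - (r + 1)))"
      using all_count_pos by (intro mult_right_mono sum_mono2) (auto intro: less_imp_le)
    also have "(\<Sum>k\<le>n. real (n choose k)) = 2 ^ n"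
      using choose_row_sum[of n] by (simp flip: of_nat_sum)
    also have "2 ^ n * (all_count (r + 1) * all_count (n - (r + 1))) = 2 ^ (r + 1) * all_count (r + 1) * all_count (n - r)"
    proof -
      obtain m where m: "n = m + (r + 1)"
        using n by (metis add_leE le_add_diff_inverse2 add.assoc mult_2 one_add_one)
      then show ?thesis
        by (simp add: all_count_def power_add numeral_2_eq_2)
    qed
    finally show ?thesis .
  qed
  moreover have "2 ^ (r + 1) * all_count (r + 1) * all_count (n - r) * 1 \<le>
      2 ^ (r + 1) * all_count (r + 1) * all_count (n - r) * real n ^ r"
    using n all_count_pos by (intro mult_left_mono one_le_power) (auto intro: less_imp_le)
  ultimately have "\<bar>middle r n\<bar> \<le> 2 * (real n ^ r * (all_count r * all_count (n - r))) +
      2 ^ (r + 1) * all_count (r + 1) * all_count (n - r) * real n ^ r"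
    by linarith
  also have "\<dots> = (2 * all_count r + 2 ^ (r + 1) * all_count (r + 1)) * (real n ^ r * all_count (n - r))"
    by (simp add: algebra_simps)
  finally show ?thesis .
qed

text \<open>
  The induction closes because \<open>n choose j\<close> contributes \<open>n\<^sup>j\<close> and the error of order \<open>r - j\<close> at \<open>n - j\<close>
  contributes \<open>n\<close> to the power \<open>r - j\<close> times the same \<open>t\<^sub>n\<^sub>-\<^sub>r\<close>, since \<open>(n - j) - (r - j) = n - r\<close>.
\<close>

lemma remainder_bigo:
  assumes "r \<ge> 1"
  shows "remainder r \<in> O(\<lambda>n. real n ^ r * all_count (n - r))"
  using assms
proof (induction r rule: less_induct)
  case (less r)
  let ?G = "\<lambda>n. real n ^ r * all_count (n - r)"
  have "middle r \<in> O(?G)"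
  proof (rule bigoI)
    show "eventually (\<lambda>n. norm (middle r n) \<le>
        (2 * all_count r + 2 ^ (r + 1) * all_count (r + 1)) * norm (real n ^ r * all_count (n - r))) sequentially"
      using eventually_ge_at_top[of "2 * r + 2"]
      by eventually_elim (use middle_bound all_count_pos in \<open>simp add: abs_mult less_imp_le\<close>)
  qed
  moreover have "(\<lambda>n. real (n choose j) * all_count j * remainder (r - j) (n - j)) \<in> O(?G)"
    if j: "j \<in> {1..<r}" for j
  proof -
    have "remainder (r - j) \<in> O(\<lambda>n. real n ^ (r - j) * all_count (n - (r - j)))"
      using j by (intro less) auto
    then have "(\<lambda>n. remainder (r - j) (n - j)) \<in>
        O(\<lambda>n. real (n - j) ^ (r - j) * all_count (n - j - (r - j)))"
      by (rule landau_o.big.compose) (rule filterlim_minus_const_nat_at_top)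
    also have "(\<lambda>n. real (n - j) ^ (r - j) * all_count (n - j - (r - j))) \<in>
        O(\<lambda>n. real n ^ (r - j) * all_count (n - r))"
    proof (rule landau_o.big_mono, rule always_eventually, rule allI)
      fix n
      have "n - j - (r - j) = n - r" using j by auto
      then show "norm (real (n - j) ^ (r - j) * all_count (n - j - (r - j)))
          \<le> norm (real n ^ (r - j) * all_count (n - r))"
        using all_count_pos by (auto simp: abs_mult less_imp_le intro!: mult_right_mono power_mono)
    qed
    finally have 1: "(\<lambda>n. remainder (r - j) (n - j)) \<in> O(\<lambda>n. real n ^ (r - j) * all_count (n - r))" .
    have 2: "(\<lambda>n. real (n choose j) * all_count j) \<in> O(\<lambda>n. real n ^ j)"
    proof (rule bigoI)
      show "eventually (\<lambda>n. norm (real (n choose j) * all_count j) \<le> all_count j * norm (real n ^ j)) sequentially"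
        using eventually_ge_at_top[of j]
      proof eventually_elim
        case (elim n)
        then have "real (n choose j) \<le> real n ^ j"
          using binomial_le_pow[of j n] by (simp flip: of_nat_power)
        then show ?case using all_count_pos[of j] by (simp add: abs_mult mult.commute)
      qed
    qed
    have "(\<lambda>n. real n ^ j * (real n ^ (r - j) * all_count (n - r))) = ?G"
      using j by (auto simp: fun_eq_iff mult.assoc[symmetric] power_add[symmetric])
    with landau_o.big.mult[OF 2 1] show ?thesis by simp
  qed
  then have "(\<lambda>n. \<Sum>j=1..<r. real (n choose j) * all_count j * remainder (r - j) (n - j)) \<in> O(?G)"
    by (rule big_sum_in_bigo)
  ultimately have "(\<lambda>n. - middle r n -
      (\<Sum>j=1..<r. real (n choose j) * all_count j * remainder (r - j) (n - j))) \<in> O(?G)"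
    by (intro sum_in_bigo) simp_all
  moreover have "eventually (\<lambda>n. - middle r n -
      (\<Sum>j=1..<r. real (n choose j) * all_count j * remainder (r - j) (n - j)) = remainder r n) sequentially"
    using eventually_ge_at_top[of "2 * r"]
    by eventually_elim (use remainder_recurrence less.prems in simp)
  ultimately show ?case using landau_o.big.in_cong by fast
qed

theorem theorem2:
  fixes r :: nat
  assumes "r \<ge> 1"
  shows "(\<lambda>n. prob_irreducible n -
            (1 - (\<Sum>k = 1..r - 1.
                    (2 * real (num_irreducible k) - real (num_two_components k)) *
                    real (n choose k) * (2 ^ (k * (k + 1) div 2) / 2 ^ (n * k)))))
         \<in> O(\<lambda>n. real n ^ r / 2 ^ (n * r))" (is "?D \<in> _")
proof -
  have c0: "exp_coeff 0 = 1"
    using num_two_components_convolution[of 0] by (simp add: exp_coeff_def num_irreducible_0)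
  have ck: "exp_coeff k = - (2 * real (num_irreducible k) - real (num_two_components k))" if "k \<ge> 1" for k
    using that by (simp add: exp_coeff_def)
  have D: "eventually (\<lambda>n. remainder r n / all_count n = ?D n) sequentially"
    using eventually_ge_at_top[of r]
  proof eventually_elim
    case (elim n)
    have "{..<r} = insert 0 {1..r - 1}" using assms by auto
    then have "(\<Sum>k<r. exp_coeff k * real (n choose k) * all_count (n - k)) / all_count n =
       (exp_coeff 0 * real (n choose 0) * all_count (n - 0) +
        (\<Sum>k=1..r - 1. exp_coeff k * real (n choose k) * all_count (n - k))) / all_count n"
      by simp
    also have "\<dots> = 1 + (\<Sum>k=1..r - 1. exp_coeff k * real (n choose k) * (all_count (n - k) / all_count n))"
      using all_count_pos[of n] by (simp add: c0 add_divide_distrib sum_divide_distrib)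
    also have "(\<Sum>k=1..r - 1. exp_coeff k * real (n choose k) * (all_count (n - k) / all_count n)) =
        (\<Sum>k=1..r - 1. - ((2 * real (num_irreducible k) - real (num_two_components k)) *
           real (n choose k) * (2 ^ (k * (k + 1) div 2) / 2 ^ (n * k))))"
    proof (intro sum.cong refl)
      fix k assume "k \<in> {1..r - 1}"
      then have "1 \<le> k" "k \<le> n" using elim by auto
      then show "exp_coeff k * real (n choose k) * (all_count (n - k) / all_count n) =
          - ((2 * real (num_irreducible k) - real (num_two_components k)) *
           real (n choose k) * (2 ^ (k * (k + 1) div 2) / 2 ^ (n * k)))"
        by (simp only: all_count_ratio ck minus_mult_left[symmetric])
    qed
    finally show ?case
      by (simp add: remainder_def diff_divide_distrib prob_irreducible_eq irr_count_def all_count_def sum_negf)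
  qed
  have "(\<lambda>n. remainder r n / all_count n) \<in> O(\<lambda>n. real n ^ r * all_count (n - r) / all_count n)"
    using remainder_bigo[OF assms] by (rule landau_o.big.divide_right[rotated])
      (use all_count_pos in \<open>auto simp: less_imp_neq[symmetric]\<close>)
  also have "(\<lambda>n. real n ^ r * all_count (n - r) / all_count n) \<in> O(\<lambda>n. real n ^ r / 2 ^ (n * r))"
  proof (rule bigoI)
    show "eventually (\<lambda>n. norm (real n ^ r * all_count (n - r) / all_count n) \<le>
        2 ^ (r * (r + 1) div 2) * norm (real n ^ r / 2 ^ (n * r))) sequentially"
      using eventually_ge_at_top[of r]
    proof eventually_elim
      case (elim n)
      have "real n ^ r * all_count (n - r) / all_count n = real n ^ r * (all_count (n - r) / all_count n)" by simp
      then show ?case by (simp add: all_count_ratio[OF elim] abs_mult mult.commute)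
    qed
  qed
  finally show ?thesis using landau_o.big.in_cong[OF D] by blast
qed

end
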